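(* A sequence $\{z_n\}_{n\ge1}$ in the open unit disc $\mathbb{D}$ is thin if and only if it is an $EIS_\infty$ sequence.
   Context: $H^\infty$ is the algebra of bounded analytic functions on $\mathbb{D}$ with the supremum norm $\|\cdot\|_\infty$. A sequence $\{z_j\}\subset\mathbb{D}$ is thin if $\lim_{j\to\infty}\prod_{k\ne j}\left|\frac{z_j-z_k}{1-\overline{z_k}z_j}\right|=1$. For a sequence $a=\{a_j\}$ and a positive integer $N$, $\|a\|_{N,\ell^\infty}:=\sup_{j\ge N}|a_j|$. The sequence $\{z_n\}$ is an eventual $1$-interpolating sequence for $H^\infty$ ($EIS_\infty$) if for every $\varepsilon>0$ there exists $N$ such that for each $a\in\ell^\infty$ there exists $f_N\in H^\infty$ (depending on $a$) with $f_N(z_n)=a_n$ for all $n\ge N$ and $\|f_N\|_\infty\le(1+\varepsilon)\|a\|_{N,\ell^\infty}$. *)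

theory Defs
  imports "HOL-Complex_Analysis.Complex_Analysis"
begin

text \<open>Sequences are indexed by the positive integers; the value at index 0 is never used.\<close>

definition pseudohyp :: "complex \<Rightarrow> complex \<Rightarrow> real" where
  "pseudohyp z w = cmod ((z - w) / (1 - cnj w * z))"

text \<open>The infinite product is the limit of its partial products. The library's
  \<^const>\<open>prodinf\<close> is unsuitable: it is unspecified when the partial products tend to
  zero without any factor being zero. The limit always exists for points of the disc, see
  \<open>thin_product_LIMSEQ\<close> below.\<close>

definition thin_product :: "(nat \<Rightarrow> complex) \<Rightarrow> nat \<Rightarrow> real" where
  "thin_product z j = lim (\<lambda>n. \<Prod>k\<in>{1..n} - {j}. pseudohyp (z j) (z k))"

definition thin :: "(nat \<Rightarrow> complex) \<Rightarrow> bool" where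
  "thin z \<longleftrightarrow> thin_product z \<longlonglongrightarrow> 1"

definition Hinf :: "(complex \<Rightarrow> complex) set" where
  "Hinf = {f. f holomorphic_on ball 0 1 \<and> bounded (f ` ball 0 1)}"

definition Hinf_norm :: "(complex \<Rightarrow> complex) \<Rightarrow> real" where
  "Hinf_norm f = (SUP w\<in>ball 0 1. cmod (f w))"

definition linf :: "(nat \<Rightarrow> complex) set" where
  "linf = {a. bounded (a ` {1..})}"

definition linf_tail_norm :: "nat \<Rightarrow> (nat \<Rightarrow> complex) \<Rightarrow> real" where
  "linf_tail_norm N a = (SUP j\<in>{N..}. cmod (a j))"

definition EIS_inf :: "(nat \<Rightarrow> complex) \<Rightarrow> bool" where
  "EIS_inf z \<longleftrightarrow>
     (\<forall>\<epsilon>>0. \<exists>N\<ge>1. \<forall>a\<in>linf. \<exists>f\<in>Hinf.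
        (\<forall>n\<ge>N. f (z n) = a n) \<and> Hinf_norm f \<le> (1 + \<epsilon>) * linf_tail_norm N a)"

lemma pseudohyp_nonneg: "0 \<le> pseudohyp z w"
  by (simp add: pseudohyp_def)

lemma pseudohyp_le_1:
  assumes "z \<in> ball 0 1" "w \<in> ball 0 1"
  shows "pseudohyp z w \<le> 1"
proof -
  have "cmod (Moebius_function 0 w z) < 1"
    using assms by (intro Moebius_function_norm_lt_1) auto
  then show ?thesis
    by (simp add: Moebius_function_def pseudohyp_def)
qed

lemma thin_product_LIMSEQ:
  assumes z: "\<And>n. n \<ge> 1 \<Longrightarrow> z n \<in> ball 0 1" and j: "j \<ge> 1"
  shows "(\<lambda>n. \<Prod>k\<in>{1..n} - {j}. pseudohyp (z j) (z k)) \<longlonglongrightarrow> thin_product z j"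
proof -
  let ?P = "\<lambda>n. \<Prod>k\<in>{1..n} - {j}. pseudohyp (z j) (z k)"
  have nonneg: "0 \<le> ?P n" for n
    by (intro prod_nonneg) (simp add: pseudohyp_nonneg)
  have "?P (Suc n) \<le> ?P n" for n
  proof (cases "Suc n = j")
    case True
    then have "{1..Suc n} - {j} = {1..n} - {j}" by auto
    then show ?thesis by simp
  next
    case False
    then have "{1..Suc n} - {j} = insert (Suc n) ({1..n} - {j})" by auto
    then have "?P (Suc n) = pseudohyp (z j) (z (Suc n)) * ?P n" by simp
    also have "\<dots> \<le> 1 * ?P n"
      using nonneg pseudohyp_le_1[OF z[OF j] z[of "Suc n"]] by (intro mult_right_mono) auto
    finally show ?thesis by simp
  qed
  then have "decseq ?P" by (rule decseq_SucI)
  then obtain L where "?P \<longlonglongrightarrow> L"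
    using decseq_convergent[of ?P 0] nonneg by blast
  then show ?thesis
    unfolding thin_product_def by (simp add: limI)
qed

end

theory Submission
  imports Defs
begin

text \<open>
  If the sequence is thin, a far tail satisfies \<open>\<Prod>\<^bsub>k \<noteq> j\<^esub> \<rho>(z\<^sub>j, z\<^sub>k) \<ge> \<delta>\<close> with \<open>\<delta>\<close> close to 1. For
  finitely many of these points a variant of P. Jones' explicit formula gives functions
  \<open>F\<^sub>j = c\<^sub>j B\<^sub>j u\<^sub>j E\<^sub>j\<close> with \<open>F\<^sub>j(z\<^sub>j) = 1\<close> and \<open>F\<^sub>j(z\<^sub>i) = 0\<close> otherwise: here \<open>B\<^sub>j\<close> is the Blaschke product with zeros \<open>z\<^sub>k\<close>,
  \<open>k \<noteq> j\<close>; \<open>u\<^sub>j\<close> is a bounded peak function with \<open>u\<^sub>j(z\<^sub>j) = 1\<close>; \<open>E\<^sub>j\<close> is the product of damping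
  factors \<open>D\<^sub>k\<close> over the \<open>k\<close> with \<open>|z\<^sub>k| \<ge> |z\<^sub>j|\<close>; and \<open>c\<^sub>j\<close> normalises. Since \<open>|u\<^sub>j| \<le> \<kappa> (1 - |D\<^sub>j|)\<close>,
  the sum \<open>\<Sum>|u\<^sub>j E\<^sub>j|\<close> telescopes and is at most \<open>\<kappa>\<close>, while \<open>|D\<^sub>k(z\<^sub>j)| \<ge> \<rho>(z\<^sub>j, z\<^sub>k)\<^sup>m\<close> keeps \<open>c\<^sub>j\<close> close
  to 1. The parameter \<open>A\<close> of \<open>u\<close> and \<open>D\<close> makes \<open>\<kappa>\<close> as close to 1 as desired, at the price of a
  large \<open>m\<close>, which is then absorbed by \<open>\<delta>\<close>. Montel's theorem passes from finite sections to the
  whole tail.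

  Conversely, interpolating a unit vector with norm \<open>1 + \<epsilon>\<close> and dividing by the Blaschke product of
  the zeros bounds the product over the tail below by \<open>1/(1 + \<epsilon>)\<close>. In particular \<open>|z\<^sub>n| \<rightarrow> 1\<close>, so
  the finitely many remaining factors tend to 1 as well.
\<close>

section \<open>The pseudohyperbolic distance\<close>

lemma pseudohyp_eq_norm_Moebius: "pseudohyp z w = cmod (Moebius_function 0 w z)"
  by (simp add: pseudohyp_def Moebius_function_simple)

lemma one_minus_cnj_mult_nonzero:
  fixes z w :: complex
  assumes "cmod z < 1" "cmod w < 1"
  shows "1 - cnj w * z \<noteq> 0"
proof -
  have "cmod (cnj w * z) < 1"
    using norm_mult_less[of "cnj w" 1 z 1] assms by simp
  then show ?thesis by auto
qed

lemma one_minus_pseudohyp_sq: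
  assumes "cmod z < 1" "cmod w < 1"
  shows "1 - (pseudohyp z w)\<^sup>2 = (1 - (cmod z)\<^sup>2) * (1 - (cmod w)\<^sup>2) / (cmod (1 - cnj w * z))\<^sup>2"
proof -
  have "(cmod (1 - cnj w * z))\<^sup>2 - (cmod (z - w))\<^sup>2 = (1 - (cmod z)\<^sup>2) * (1 - (cmod w)\<^sup>2)"
    by (simp only: cmod_power2) (simp add: power2_eq_square algebra_simps)
  then show ?thesis
    using one_minus_cnj_mult_nonzero[OF assms]
    by (simp add: pseudohyp_def norm_divide power_divide field_simps)
qed

subsection \<open>Interpolation on finite sets\<close>

text \<open>
  With \<open>t = (1 - |w|\<^sup>2) / (1 - cnj w * z)\<close>, which lies in the right half plane,
  \<open>peak\<close> is at most \<open>((A + 1) / A)\<^sup>2 * min 1 (A |t|)\<^sup>2\<close>, and \<open>damper\<close> is at most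
  \<open>exp (- A (A |t|)\<^sup>2)\<close>.
\<close>

definition peak :: "nat \<Rightarrow> complex \<Rightarrow> complex \<Rightarrow> complex" where
  "peak A w z = ((of_nat A + 1) / (of_nat A + (1 - cnj w * z) / of_real (1 - (cmod w)\<^sup>2)))\<^sup>2"

definition damper :: "nat \<Rightarrow> complex \<Rightarrow> complex \<Rightarrow> complex" where
  "damper A w z = exp (- of_nat (A ^ 3) * (of_real (1 - (cmod w)\<^sup>2) * ((1 + cnj w * z) / (1 - cnj w * z))))"

lemma Re_inverse_kernel_nonneg:
  assumes "cmod z < 1" "cmod w < 1"
  shows "0 \<le> Re ((1 - cnj w * z) / of_real (1 - (cmod w)\<^sup>2))"
proof -
  have "0 < 1 - (cmod w)\<^sup>2"
    using assms by (simp add: abs_square_less_1)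
  moreover have "cmod (cnj w * z) < 1"
    using norm_mult_less[of "cnj w" 1 z 1] assms by simp
  then have "0 \<le> Re (1 - cnj w * z)"
    using complex_Re_le_cmod[of "cnj w * z"] by simp
  ultimately show ?thesis
    unfolding Re_divide_of_real by (intro divide_nonneg_pos)
qed

lemma peak_self:
  assumes "cmod w < 1"
  shows "peak A w w = 1"
proof -
  have "1 - cnj w * w = of_real (1 - (cmod w)\<^sup>2)"
    using complex_norm_square[of w] by (simp add: mult.commute)
  moreover have "0 < 1 - (cmod w)\<^sup>2"
    using assms by (simp add: abs_square_less_1)
  moreover have "(of_nat A + 1 :: complex) \<noteq> 0"
    by (metis of_nat_Suc add.commute of_nat_neq_0)
  ultimately show ?thesis
    by (simp add: peak_def del: of_real_diff)
qed

lemma holomorphic_peak: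
  assumes "cmod w < 1" "A > 0"
  shows "peak A w holomorphic_on ball 0 1"
proof -
  have nz: "of_nat A + (1 - cnj w * z) / of_real (1 - (cmod w)\<^sup>2) \<noteq> 0" if "z \<in> ball 0 1" for z
  proof -
    have "0 < Re (of_nat A + (1 - cnj w * z) / of_real (1 - (cmod w)\<^sup>2))"
      using Re_inverse_kernel_nonneg[of z w] assms that by (simp only: plus_complex.sel) simp
    then show ?thesis by (metis less_irrefl zero_complex.sel(1))
  qed
  have "of_real (1 - (cmod w)\<^sup>2) \<noteq> (0 :: complex)"
    using assms by (simp add: abs_square_eq_1 del: of_real_diff)
  then show ?thesis
    unfolding peak_def by (intro holomorphic_intros nz) auto
qed

lemma holomorphic_damper:
  assumes "cmod w < 1"
  shows "damper A w holomorphic_on ball 0 1"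
  unfolding damper_def using assms one_minus_cnj_mult_nonzero
  by (intro holomorphic_intros) auto

lemma norm_damper:
  assumes "cmod z < 1" "cmod w < 1"
  shows "cmod (damper A w z) =
    exp (- real (A ^ 3) * ((1 - (cmod w)\<^sup>2) * (1 - (cmod w * cmod z)\<^sup>2) / (cmod (1 - cnj w * z))\<^sup>2))"
proof -
  \<comment> \<open>This is the Poisson kernel, so the exponent of \<open>damper\<close> has an
    explicit real part.\<close>
  have "Re ((1 + u) / (1 - u)) = (1 - (cmod u)\<^sup>2) / (cmod (1 - u))\<^sup>2" for u
    by (simp add: Re_divide cmod_power2) (simp add: power2_eq_square algebra_simps)
  from this[of "cnj w * z"]
  have "Re ((1 + cnj w * z) / (1 - cnj w * z)) = (1 - (cmod w * cmod z)\<^sup>2) / (cmod (1 - cnj w * z))\<^sup>2"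
    by (simp add: norm_mult)
  moreover have "cmod (exp (- of_nat n * (of_real m * v))) = exp (- real n * (m * Re v))" for n m v
    by simp
  ultimately show ?thesis
    unfolding damper_def by (simp only: times_divide_eq_right[symmetric])
qed

lemma norm_damper_le_1:
  assumes "cmod z < 1" "cmod w < 1"
  shows "cmod (damper A w z) \<le> 1"
proof -
  have "cmod w * cmod z \<le> 1"
    using assms by (simp add: mult_le_one less_imp_le)
  then have "0 \<le> (1 - (cmod w)\<^sup>2) * (1 - (cmod w * cmod z)\<^sup>2) / (cmod (1 - cnj w * z))\<^sup>2"
    using assms by (intro divide_nonneg_nonneg mult_nonneg_nonneg) (auto simp: power_le_one)
  then show ?thesis
    unfolding norm_damper[OF assms] exp_le_one_iff mult_minus_left neg_le_0_iff_le
    by (rule mult_nonneg_nonneg[OF of_nat_0_le_iff])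
qed

text \<open>
  Only here is the ordering by modulus needed: it gives \<open>1 - |wz|\<^sup>2 \<le> 2 (1 - |z|\<^sup>2)\<close>.
\<close>

lemma norm_damper_ge_pseudohyp_power:
  assumes "cmod z < 1" "cmod w < 1" "cmod z \<le> cmod w"
  shows "pseudohyp z w ^ (4 * A ^ 3) \<le> cmod (damper A w z)"
proof -
  let ?r = "pseudohyp z w"
  have w: "0 \<le> 1 - (cmod w)\<^sup>2"
    using assms by (simp add: power_le_one)
  have "(cmod z)\<^sup>2 \<le> (cmod w)\<^sup>2"
    using assms by (simp add: power_mono)
  \<comment> \<open>This gives 1 - |wz|^2 <= 1 - |z|^4, and 2 (1 - |z|^2) - (1 - |z|^4) is the
    square in the next fact.\<close>
  moreover have "(cmod z)\<^sup>2 * (cmod z)\<^sup>2 \<le> (cmod w)\<^sup>2 * (cmod z)\<^sup>2"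
    using calculation by (rule mult_right_mono) simp
  moreover have "0 \<le> (1 - (cmod z)\<^sup>2)\<^sup>2" by simp
  ultimately have "1 - (cmod w * cmod z)\<^sup>2 \<le> 2 * (1 - (cmod z)\<^sup>2)"
    by (simp add: power2_eq_square algebra_simps)
  then have "(1 - (cmod w)\<^sup>2) * (1 - (cmod w * cmod z)\<^sup>2) / (cmod (1 - cnj w * z))\<^sup>2
      \<le> (1 - (cmod w)\<^sup>2) * (2 * (1 - (cmod z)\<^sup>2)) / (cmod (1 - cnj w * z))\<^sup>2"
    using w by (intro divide_right_mono mult_left_mono) auto
  also have "\<dots> = 2 * (1 - ?r\<^sup>2)"
    unfolding one_minus_pseudohyp_sq[OF assms(1,2)] by simp
  finally have q: "(1 - (cmod w)\<^sup>2) * (1 - (cmod w * cmod z)\<^sup>2) / (cmod (1 - cnj w * z))\<^sup>2 \<le> 2 * (1 - ?r\<^sup>2)" .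
  have "real (2 * A ^ 3) * (?r\<^sup>2 - 1)
      \<le> - real (A ^ 3) * ((1 - (cmod w)\<^sup>2) * (1 - (cmod w * cmod z)\<^sup>2) / (cmod (1 - cnj w * z))\<^sup>2)"
  proof -
    have "real (2 * A ^ 3) * (?r\<^sup>2 - 1) \<le> - real (A ^ 3) * q" if "q \<le> 2 * (1 - ?r\<^sup>2)" for q
      using mult_left_mono[OF that, of "real (A ^ 3)"] by (simp add: algebra_simps)
    then show ?thesis
      using q .
  qed
  then have "exp (real (2 * A ^ 3) * (?r\<^sup>2 - 1)) \<le> cmod (damper A w z)"
    unfolding norm_damper[OF assms(1,2)] by simp
  \<comment> \<open>From 1 + x <= exp x at x = \<open>?r\<^sup>2 - 1\<close>. Raising to the power
    \<open>2 * A ^ 3\<close> turns the square into the exponent \<open>4 * A ^ 3\<close>.\<close>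
  moreover have "(?r\<^sup>2) ^ (2 * A ^ 3) \<le> exp (?r\<^sup>2 - 1) ^ (2 * A ^ 3)"
    using exp_ge_add_one_self[of "?r\<^sup>2 - 1"] by (intro power_mono) auto
  ultimately show ?thesis
    by (simp only: exp_of_nat_mult flip: power_mult) simp
qed

text \<open>As a function of x, the right side is concave and increasing: on [0, 1] it lies above
  its chord, and beyond 1 it exceeds its value at 1.\<close>

lemma min_one_le_exp_ratio:
  fixes x M :: real
  assumes "0 \<le> x" "0 < M"
  shows "min 1 x * (1 - exp (- M)) \<le> 1 - exp (- (M * x))"
proof (cases "x \<le> 1")
  case True
  have "exp ((1 - x) *\<^sub>R 0 + x *\<^sub>R (- M)) \<le> (1 - x) * exp 0 + x * exp (- M)"
    using assms True by (intro convex_onD[OF exp_convex]) auto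
  then show ?thesis
    using True by (simp add: algebra_simps)
next
  case False
  then have "M * 1 \<le> M * x"
    using assms by (intro mult_left_mono) auto
  then show ?thesis using False by simp
qed

text \<open>The constant \<open>\<kappa>\<close> of the overview. The square comes from normalising
  \<open>peak\<close>, the denominator from \<open>min_one_le_exp_ratio\<close> with M = A.\<close>

definition interp_const :: "nat \<Rightarrow> real" where
  "interp_const A = ((real A + 1) / real A)\<^sup>2 / (1 - exp (- real A))"

text \<open>Since Re s >= 0, |A + s| is at least both A and |s|, so \<open>peak\<close> is at most
  ((A + 1) / A)^2 min(1, x). Since 1 - |wz|^2 >= 1 - |w|^2, \<open>damper\<close> is at most exp (-
  A x). The chord bound \<open>min_one_le_exp_ratio\<close> compares the two; the factor A^3 in
  \<open>damper\<close> is what leaves a spare A in the exponent.\<close>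

lemma norm_peak_le:
  assumes "cmod z < 1" "cmod w < 1" "A > 0"
  shows "cmod (peak A w z) \<le> interp_const A * (1 - cmod (damper A w z))"
proof -
  define s where "s = (1 - cnj w * z) / of_real (1 - (cmod w)\<^sup>2)"
  define x where "x = (real A / cmod s)\<^sup>2"
  have w: "0 < 1 - (cmod w)\<^sup>2"
    using assms by (simp add: power_less_one_iff abs_square_less_1)
  have s0: "s \<noteq> 0"
    using one_minus_cnj_mult_nonzero[OF assms(1,2)] w
    unfolding s_def by (simp del: of_real_diff)
  have Re_s: "Re s \<ge> 0"
    unfolding s_def using assms by (intro Re_inverse_kernel_nonneg)
  have n1: "real A \<le> cmod (of_nat A + s)"
    using complex_Re_le_cmod[of "of_nat A + s"] Re_s by simp
  have "(cmod s)\<^sup>2 \<le> (cmod (of_nat A + s))\<^sup>2"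
    using Re_s by (simp add: cmod_power2 power_mono)
  then have n2: "cmod s \<le> cmod (of_nat A + s)"
    by (rule power2_le_imp_le) simp
  have "(real A)\<^sup>2 = (cmod s)\<^sup>2 * x"
    using s0 by (simp add: x_def power_divide)
  also have "\<dots> \<le> (cmod (of_nat A + s))\<^sup>2 * x"
    using n2 by (intro mult_right_mono power_mono) (auto simp: x_def)
  finally have "(real A)\<^sup>2 \<le> (cmod (of_nat A + s))\<^sup>2 * x" .
  moreover have "(real A)\<^sup>2 \<le> (cmod (of_nat A + s))\<^sup>2"
    using n1 by (simp add: power_mono)
  ultimately have "(real A)\<^sup>2 \<le> (cmod (of_nat A + s))\<^sup>2 * min 1 x"
    by (simp add: min_def)
  moreover have A': "0 < cmod (of_nat A + s)"
    using n1 assms by linarith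
  ultimately have "(real A / cmod (of_nat A + s))\<^sup>2 \<le> min 1 x"
    unfolding power_divide by (subst pos_divide_le_eq) (simp_all only: zero_less_power mult.commute)
  then have "((real A + 1) / real A)\<^sup>2 * (real A / cmod (of_nat A + s))\<^sup>2 \<le> ((real A + 1) / real A)\<^sup>2 * min 1 x"
    by (intro mult_left_mono) auto
  moreover have "cmod (peak A w z) = ((real A + 1) / real A)\<^sup>2 * (real A / cmod (of_nat A + s))\<^sup>2"
  proof -
    have "cmod (of_nat A + 1) = real A + 1"
      by (metis norm_of_nat of_nat_Suc add.commute)
    then show ?thesis
      using \<open>A > 0\<close>
      by (simp add: peak_def s_def norm_power norm_divide power_divide del: of_real_diff)
  qed
  ultimately have peak: "cmod (peak A w z) \<le> ((real A + 1) / real A)\<^sup>2 * min 1 x"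
    by simp
  have "real A * x = real (A ^ 3) * ((1 - (cmod w)\<^sup>2) * (1 - (cmod w)\<^sup>2) / (cmod (1 - cnj w * z))\<^sup>2)"
  proof -
    have "cmod s = cmod (1 - cnj w * z) / (1 - (cmod w)\<^sup>2)"
      unfolding s_def using w by (simp add: norm_divide del: of_real_diff)
    then show ?thesis
      by (simp add: x_def power_divide power2_eq_square power3_eq_cube)
  qed
  also have "\<dots> \<le> real (A ^ 3) * ((1 - (cmod w)\<^sup>2) * (1 - (cmod w * cmod z)\<^sup>2) / (cmod (1 - cnj w * z))\<^sup>2)"
  proof -
    have "(cmod w * cmod z)\<^sup>2 \<le> (cmod w)\<^sup>2"
      using assms by (intro power_mono) (auto simp: mult_left_le)
    then show ?thesis
      using w by (intro mult_left_mono divide_right_mono) auto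
  qed
  finally have "cmod (damper A w z) \<le> exp (- (real A * x))"
    unfolding norm_damper[OF assms(1,2)] by simp
  moreover have "min 1 x * (1 - exp (- real A)) \<le> 1 - exp (- (real A * x))"
    using assms by (intro min_one_le_exp_ratio) (auto simp: x_def)
  ultimately have "min 1 x * (1 - exp (- real A)) \<le> 1 - cmod (damper A w z)"
    by linarith
  then have "min 1 x \<le> (1 - cmod (damper A w z)) / (1 - exp (- real A))"
    using assms by (simp add: field_simps)
  then have "((real A + 1) / real A)\<^sup>2 * min 1 x
      \<le> ((real A + 1) / real A)\<^sup>2 * ((1 - cmod (damper A w z)) / (1 - exp (- real A)))"
    by (intro mult_left_mono) auto
  with peak show ?thesis
    by (simp add: interp_const_def)
qed

lemma prod_mono_superset:
  fixes d :: "'a \<Rightarrow> real"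
  assumes "finite B" "A \<subseteq> B" "\<And>k. k \<in> B \<Longrightarrow> 0 \<le> d k" "\<And>k. k \<in> B \<Longrightarrow> d k \<le> 1"
  shows "prod d B \<le> prod d A"
proof -
  have "prod d B = prod d (B - A) * prod d A"
    using assms by (simp add: prod.subset_diff)
  also have "\<dots> \<le> 1 * prod d A"
    using assms by (intro mult_right_mono prod_le_1 prod_nonneg) auto
  finally show ?thesis by simp
qed

text \<open>Elements are inserted in order of decreasing \<open>r\<close>. The new element m then
  carries the product P over all of S, and (1 - P) + (1 - d m) P = 1 - d m P.\<close>

lemma sum_telescope_le_1:
  fixes d r :: "'a \<Rightarrow> real"
  assumes "finite S" "\<And>k. k \<in> S \<Longrightarrow> 0 \<le> d k \<and> d k \<le> 1"
  shows "(\<Sum>j\<in>S. (1 - d j) * (\<Prod>k\<in>{k\<in>S. k \<noteq> j \<and> r j \<le> r k}. d k)) \<le> 1 - (\<Prod>k\<in>S. d k)"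
  using assms
proof (induction S rule: finite_ranking_induct[where f = "\<lambda>k. - r k"])
  case empty
  then show ?case by simp
next
  case (insert m S)
  show ?case
  proof (cases "m \<in> S")
    case True
    then show ?thesis using insert by (simp add: insert_absorb)
  next
    case False
    have d: "0 \<le> d k" "d k \<le> 1" if "k \<in> insert m S" for k
      using insert.prems that by blast+
    \<comment> \<open>Inserting m can affect an old product only at a tie \<open>r j = r m\<close>,
      and then only by a factor at most 1.\<close>
    have "(\<Sum>j\<in>S. (1 - d j) * (\<Prod>k\<in>{k\<in>insert m S. k \<noteq> j \<and> r j \<le> r k}. d k))
        \<le> (\<Sum>j\<in>S. (1 - d j) * (\<Prod>k\<in>{k\<in>S. k \<noteq> j \<and> r j \<le> r k}. d k))"
      using insert.hyps d
      by (intro sum_mono mult_left_mono prod_mono_superset) auto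
    also have "\<dots> \<le> 1 - (\<Prod>k\<in>S. d k)"
      using insert d by auto
    finally have "(\<Sum>j\<in>S. (1 - d j) * (\<Prod>k\<in>{k\<in>insert m S. k \<noteq> j \<and> r j \<le> r k}. d k)) \<le> 1 - (\<Prod>k\<in>S. d k)" .
    moreover have "{k\<in>insert m S. k \<noteq> m \<and> r m \<le> r k} = S"
      using False insert.hyps by auto
    ultimately show ?thesis
      using False insert.hyps by (simp add: algebra_simps)
  qed
qed

lemma finite_interpolation:
  fixes z a :: "'a \<Rightarrow> complex"
  assumes S: "finite S" and z: "\<And>k. k \<in> S \<Longrightarrow> cmod (z k) < 1"
    and \<delta>: "0 < \<delta>" "\<And>j. j \<in> S \<Longrightarrow> \<delta> \<le> (\<Prod>k\<in>S - {j}. pseudohyp (z j) (z k))"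
    and A: "A > 0" and a: "\<And>j. j \<in> S \<Longrightarrow> cmod (a j) \<le> L" and L: "0 \<le> L"
  obtains f where "f holomorphic_on ball 0 1" "\<And>j. j \<in> S \<Longrightarrow> f (z j) = a j"
    "\<And>w. w \<in> ball 0 1 \<Longrightarrow> cmod (f w) \<le> interp_const A / \<delta> ^ (1 + 4 * A ^ 3) * L"
proof -
  define T where "T j = {k\<in>S. k \<noteq> j \<and> cmod (z j) \<le> cmod (z k)}" for j
  define B where "B j w = (\<Prod>k\<in>S - {j}. Moebius_function 0 (z k) w)" for j w
  define E where "E j w = (\<Prod>k\<in>T j. damper A (z k) w)" for j w
  define G where "G j w = B j w * E j w * peak A (z j) w" for j w
  define f where "f w = (\<Sum>j\<in>S. a j * (G j w / G j (z j)))" for w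
  \<comment> \<open>One power of \<open>\<delta>\<close> pays for the Blaschke product at
    \<open>z j\<close>, the other \<open>4 * A ^ 3\<close> for the dampers there;
    \<open>peak\<close> equals 1 at that point.\<close>
  define p where "p = 1 + 4 * A ^ 3"
  have T: "T j \<subseteq> S - {j}" "finite (T j)" for j
    using S by (auto simp: T_def)
  have rho: "0 \<le> pseudohyp (z j) (z k)" "pseudohyp (z j) (z k) \<le> 1" if "j \<in> S" "k \<in> S" for j k
    using that z by (auto simp: pseudohyp_nonneg intro!: pseudohyp_le_1)
  have low: "\<delta> ^ p \<le> cmod (G j (z j))" if j: "j \<in> S" for j
  proof -
    let ?P = "\<Prod>k\<in>S - {j}. pseudohyp (z j) (z k)"
    \<comment> \<open>The dampers run only over \<open>T j\<close>; dropping the other factors, each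
      at most 1, increases the product.\<close>
    have "?P ^ (4 * A ^ 3) \<le> (\<Prod>k\<in>T j. pseudohyp (z j) (z k)) ^ (4 * A ^ 3)"
      using S T rho j by (intro power_mono prod_mono_superset prod_nonneg) auto
    also have "\<dots> = (\<Prod>k\<in>T j. pseudohyp (z j) (z k) ^ (4 * A ^ 3))"
      by (simp add: prod_power_distrib)
    also have "\<dots> \<le> (\<Prod>k\<in>T j. cmod (damper A (z k) (z j)))"
      using j z by (intro prod_mono conjI norm_damper_ge_pseudohyp_power)
        (auto simp: T_def pseudohyp_nonneg)
    also have "\<dots> = cmod (E j (z j))"
      by (simp add: E_def prod_norm)
    finally have E: "?P ^ (4 * A ^ 3) \<le> cmod (E j (z j))" .
    have B: "cmod (B j (z j)) = ?P"
      by (simp add: B_def pseudohyp_eq_norm_Moebius flip: prod_norm)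
    have "\<delta> ^ p \<le> ?P ^ p"
      using \<delta> j by (intro power_mono) auto
    also have "\<dots> = ?P * ?P ^ (4 * A ^ 3)"
      by (simp add: p_def)
    also have "\<dots> \<le> ?P * cmod (E j (z j))"
      using E by (intro mult_left_mono prod_nonneg) (auto simp: pseudohyp_nonneg)
    also have "\<dots> = cmod (G j (z j))"
      using z[OF j] by (simp add: G_def norm_mult B peak_self)
    finally show ?thesis .
  qed
  have G0: "G j (z j) \<noteq> 0" if "j \<in> S" for j
    using low[OF that] \<delta>(1) by (smt (verit) norm_zero zero_less_power)
  have Gzero: "G j (z i) = 0" if "i \<in> S" "i \<noteq> j" for i j
    using that S by (auto simp: G_def B_def Moebius_function_eq_zero intro!: prod_zero bexI[of _ i])
  show thesis
  proof
    show "f holomorphic_on ball 0 1"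
      unfolding f_def G_def B_def E_def divide_inverse using z A T
      by (intro holomorphic_intros Moebius_function_holomorphic holomorphic_peak holomorphic_damper) auto
    show "f (z i) = a i" if "i \<in> S" for i
    proof -
      have "f (z i) = (\<Sum>j\<in>S. if j = i then a i else 0)"
        unfolding f_def using G0 Gzero that by (intro sum.cong) auto
      then show ?thesis using S that by simp
    qed
  next
    fix w :: complex
    assume "w \<in> ball 0 1"
    then have w: "cmod w < 1" by simp
    have ic: "0 \<le> interp_const A"
      using A by (simp add: interp_const_def)
    let ?d = "\<lambda>k. cmod (damper A (z k) w)"
    have summand: "cmod (a j * (G j w / G j (z j)))
        \<le> L * (interp_const A / \<delta> ^ p) * ((1 - ?d j) * (\<Prod>k\<in>T j. ?d k))" if j: "j \<in> S" for j
    proof -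
      have "cmod (B j w) \<le> 1"
        unfolding B_def prod_norm[symmetric] using z w
        by (intro prod_le_1) (auto intro!: less_imp_le Moebius_function_norm_lt_1)
      then have G_le: "cmod (G j w) \<le> 1 * (\<Prod>k\<in>T j. ?d k) * (interp_const A * (1 - ?d j))"
        unfolding G_def E_def norm_mult prod_norm[symmetric] using z w A j
        by (intro mult_mono norm_peak_le mult_nonneg_nonneg prod_nonneg) auto
      have "cmod (G j w) / cmod (G j (z j)) \<le>
          (1 * (\<Prod>k\<in>T j. ?d k) * (interp_const A * (1 - ?d j))) / \<delta> ^ p"
        using low[OF j] \<delta>(1) order_trans[OF norm_ge_zero G_le] G_le by (intro frac_le) auto
      then have "cmod (a j) * (cmod (G j w) / cmod (G j (z j)))
          \<le> L * ((1 * (\<Prod>k\<in>T j. ?d k) * (interp_const A * (1 - ?d j))) / \<delta> ^ p)"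
        using a[OF j] L by (intro mult_mono) auto
      then show ?thesis
        by (simp add: norm_mult norm_divide mult_ac)
    qed
    have "cmod (f w) \<le> (\<Sum>j\<in>S. cmod (a j * (G j w / G j (z j))))"
      unfolding f_def by (rule norm_sum)
    also have "\<dots> \<le> (\<Sum>j\<in>S. L * (interp_const A / \<delta> ^ p) * ((1 - ?d j) * (\<Prod>k\<in>T j. ?d k)))"
      using summand by (rule sum_mono)
    also have "\<dots> = L * (interp_const A / \<delta> ^ p) * (\<Sum>j\<in>S. (1 - ?d j) * (\<Prod>k\<in>T j. ?d k))"
      by (simp add: sum_distrib_left)
    also have "\<dots> \<le> L * (interp_const A / \<delta> ^ p) * (1 - (\<Prod>k\<in>S. ?d k))"
      unfolding T_def using S z w ic L \<delta>(1)
      by (intro mult_left_mono sum_telescope_le_1) (auto intro: norm_damper_le_1)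
    also have "\<dots> \<le> L * (interp_const A / \<delta> ^ p) * 1"
      using ic L \<delta>(1) by (intro mult_left_mono) (auto intro: prod_nonneg)
    finally show "cmod (f w) \<le> interp_const A / \<delta> ^ (1 + 4 * A ^ 3) * L"
      by (simp add: p_def mult_ac)
  qed
qed

section \<open>Thin sequences are eventually interpolating\<close>

lemma interp_const_tendsto_1: "interp_const \<longlonglongrightarrow> 1"
proof -
  have "(\<lambda>A. exp (- real A)) \<longlonglongrightarrow> 0"
    by (intro filterlim_compose[OF exp_at_bot] filterlim_compose[OF filterlim_uminus_at_bot_at_top]
        filterlim_real_sequentially)
  then have "(\<lambda>A. (1 + inverse (real A))\<^sup>2 / (1 - exp (- real A))) \<longlonglongrightarrow> (1 + 0)\<^sup>2 / (1 - 0)"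
    by (intro tendsto_intros lim_inverse_n) auto
  moreover have "\<forall>\<^sub>F A in sequentially. (1 + inverse (real A))\<^sup>2 / (1 - exp (- real A)) = interp_const A"
    using eventually_gt_at_top[of 0]
    by eventually_elim (simp add: interp_const_def field_simps)
  ultimately show ?thesis
    using tendsto_cong by force
qed

lemma linf_tail_bounds:
  assumes "a \<in> linf" "N \<ge> 1"
  shows "n \<ge> N \<Longrightarrow> cmod (a n) \<le> linf_tail_norm N a" "0 \<le> linf_tail_norm N a"
proof -
  obtain K where K: "\<And>n. n \<ge> 1 \<Longrightarrow> cmod (a n) \<le> K"
    using assms by (auto simp: linf_def bounded_iff)
  have "bdd_above ((\<lambda>j. cmod (a j)) ` {N..})"
    using K assms by (intro bdd_aboveI2[of _ _ K]) auto
  then have *: "cmod (a n) \<le> linf_tail_norm N a" if "n \<ge> N" for n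
    unfolding linf_tail_norm_def using that by (intro cSUP_upper) auto
  show "n \<ge> N \<Longrightarrow> cmod (a n) \<le> linf_tail_norm N a" by (rule *)
  show "0 \<le> linf_tail_norm N a"
    using *[of N] norm_ge_zero[of "a N"] by linarith
qed

lemma norm_le_Hinf_norm:
  assumes "f \<in> Hinf" "w \<in> ball 0 1"
  shows "cmod (f w) \<le> Hinf_norm f"
proof -
  obtain K where "\<And>x. x \<in> ball 0 1 \<Longrightarrow> cmod (f x) \<le> K"
    using assms(1) unfolding Hinf_def bounded_iff by blast
  then have "bdd_above ((\<lambda>w. cmod (f w)) ` ball 0 1)"
    by (intro bdd_aboveI2)
  then show ?thesis
    unfolding Hinf_norm_def using assms by (intro cSUP_upper)
qed

lemma thin_product_le_prod:
  assumes z: "\<And>n. n \<ge> 1 \<Longrightarrow> z n \<in> ball 0 1" and "j \<ge> 1" "finite S" "S \<subseteq> {1..} - {j}"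
  shows "thin_product z j \<le> (\<Prod>k\<in>S. pseudohyp (z j) (z k))"
proof (rule LIMSEQ_le_const2[OF thin_product_LIMSEQ[OF z \<open>j \<ge> 1\<close>]])
  obtain m where "S \<subseteq> {..m}"
    using \<open>finite S\<close> finite_nat_iff_bounded_le by blast
  then have "(\<Prod>k\<in>{1..n} - {j}. pseudohyp (z j) (z k)) \<le> (\<Prod>k\<in>S. pseudohyp (z j) (z k))" if "n \<ge> m" for n
    using assms that by (intro prod_mono_superset pseudohyp_le_1 pseudohyp_nonneg) force+
  then show "\<exists>M. \<forall>n\<ge>M. (\<Prod>k\<in>{1..n} - {j}. pseudohyp (z j) (z k)) \<le> (\<Prod>k\<in>S. pseudohyp (z j) (z k))"
    by blast
qed

lemma thin_imp_EIS_inf: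
  assumes z: "\<And>n. n \<ge> 1 \<Longrightarrow> z n \<in> ball 0 1" and "thin z"
  shows "EIS_inf z"
  unfolding EIS_inf_def
proof (intro allI impI)
  fix \<epsilon> :: real
  assume "\<epsilon> > 0"
  \<comment> \<open>\<open>A\<close> is fixed before \<open>\<delta>\<close>, because the exponent
    of \<open>\<delta>\<close> depends on \<open>A\<close>.\<close>
  then have "\<forall>\<^sub>F A in sequentially. interp_const A < 1 + \<epsilon>"
    using interp_const_tendsto_1 by (intro order_tendstoD(2)) auto
  then have "\<forall>\<^sub>F A in sequentially. interp_const A < 1 + \<epsilon> \<and> A > 0"
    using eventually_gt_at_top[of 0] by (rule eventually_conj)
  then obtain A where A: "interp_const A < 1 + \<epsilon>" "A > 0"
    using eventually_happens'[OF sequentially_bot] by blast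
  let ?p = "1 + 4 * A ^ 3"
  have "((\<lambda>x. interp_const A / x ^ ?p) \<longlongrightarrow> interp_const A / 1 ^ ?p) (at_left 1)"
    by (rule tendsto_intros | simp)+
  then have "\<forall>\<^sub>F x in at_left 1. interp_const A / x ^ ?p < 1 + \<epsilon>"
    using A by (intro order_tendstoD(2)) auto
  moreover have "\<forall>\<^sub>F x in at_left 1. x \<in> {0<..<1::real}"
    by (rule eventually_at_left_real) simp
  ultimately have "\<forall>\<^sub>F x in at_left 1. interp_const A / x ^ ?p < 1 + \<epsilon> \<and> x \<in> {0<..<1}"
    by (rule eventually_conj)
  then obtain \<delta> where \<delta>: "interp_const A / \<delta> ^ ?p < 1 + \<epsilon>" "0 < \<delta>" "\<delta> < 1"
    using eventually_happens'[OF trivial_limit_at_left_real] by force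
  have "\<forall>\<^sub>F j in sequentially. thin_product z j > \<delta>"
    using \<open>thin z\<close> \<delta> unfolding thin_def by (intro order_tendstoD(1)) auto
  then obtain N0 where N0: "\<And>j. j \<ge> N0 \<Longrightarrow> thin_product z j > \<delta>"
    by (auto simp: eventually_sequentially)
  define N where "N = max 1 N0"
  have "\<exists>f\<in>Hinf. (\<forall>n\<ge>N. f (z n) = a n) \<and> Hinf_norm f \<le> (1 + \<epsilon>) * linf_tail_norm N a"
    if "a \<in> linf" for a
  proof -
    let ?L = "linf_tail_norm N a" and ?C = "(1 + \<epsilon>) * linf_tail_norm N a"
    have a: "\<And>n. n \<ge> N \<Longrightarrow> cmod (a n) \<le> ?L" and L: "0 \<le> ?L"
      using linf_tail_bounds[OF that, of N] by (auto simp: N_def)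
    \<comment> \<open>The bound \<open>?C\<close> does not depend on the length n of the section,
      which is what Montel's theorem requires.\<close>
    have "\<exists>f. f holomorphic_on ball 0 1 \<and> (\<forall>j\<in>{N..N + n}. f (z j) = a j) \<and> (\<forall>w\<in>ball 0 1. cmod (f w) \<le> ?C)" for n
    proof -
      have prod_ge: "\<delta> \<le> (\<Prod>k\<in>{N..N + n} - {j}. pseudohyp (z j) (z k))" if "j \<in> {N..N + n}" for j
      proof -
        have "\<delta> \<le> thin_product z j"
          using N0[of j] that by (simp add: N_def)
        also have "\<dots> \<le> (\<Prod>k\<in>{N..N + n} - {j}. pseudohyp (z j) (z k))"
          using z that by (intro thin_product_le_prod) (auto simp: N_def)
        finally show ?thesis .
      qed
      have z': "cmod (z k) < 1" if "k \<in> {N..N + n}" for k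
        using z[of k] that by (simp add: N_def)
      obtain f where f: "f holomorphic_on ball 0 1" "\<And>j. j \<in> {N..N + n} \<Longrightarrow> f (z j) = a j"
          "\<And>w. w \<in> ball 0 1 \<Longrightarrow> cmod (f w) \<le> interp_const A / \<delta> ^ ?p * ?L"
      proof (rule finite_interpolation[of "{N..N + n}" z \<delta> A a ?L])
        show "cmod (a j) \<le> ?L" if "j \<in> {N..N + n}" for j
          using that a by simp
      qed (use z' prod_ge \<delta> A L in blast)+
      moreover have "interp_const A / \<delta> ^ ?p * ?L \<le> ?C"
        using \<delta>(1) L by (intro mult_right_mono) auto
      ultimately show ?thesis
        by (meson order_trans)
    qed
    then obtain F where F: "\<And>n. F n holomorphic_on ball 0 1" "\<And>n j. j \<in> {N..N + n} \<Longrightarrow> F n (z j) = a j"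
        "\<And>n w. w \<in> ball 0 1 \<Longrightarrow> cmod (F n w) \<le> ?C"
      by metis
    obtain g r where g: "g holomorphic_on ball 0 1" and r: "strict_mono (r :: nat \<Rightarrow> nat)"
        and lim: "\<And>w. w \<in> ball 0 1 \<Longrightarrow> (\<lambda>n. F (r n) w) \<longlonglongrightarrow> g w"
    proof (rule Montel[of "ball 0 1" "range F" F])
      show "\<exists>B. \<forall>h\<in>range F. \<forall>w\<in>K. cmod (h w) \<le> B" if "K \<subseteq> ball 0 1" for K
        using F(3) that by blast
    qed (use F(1) in auto)
    have g_le: "cmod (g w) \<le> ?C" if "w \<in> ball 0 1" for w
      using tendsto_norm[OF lim[OF that]] F(3)[OF that] by (intro LIMSEQ_le_const2) auto
    have "g (z k) = a k" if "k \<ge> N" for k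
    proof (rule LIMSEQ_unique)
      show "(\<lambda>n. F (r n) (z k)) \<longlonglongrightarrow> g (z k)"
        using z that by (intro lim) (auto simp: N_def)
      \<comment> \<open>Because r n >= n >= k, the index k already lies in the section treated by
        \<open>F (r n)\<close>.\<close>
      have "F (r n) (z k) = a k" if "n \<ge> k" for n
        using seq_suble[OF r, of n] that \<open>k \<ge> N\<close> by (intro F(2)) auto
      then show "(\<lambda>n. F (r n) (z k)) \<longlonglongrightarrow> a k"
        by (intro tendsto_eventually eventually_sequentiallyI)
    qed
    moreover have "g \<in> Hinf"
      using g g_le unfolding Hinf_def bounded_iff by blast
    moreover have "Hinf_norm g \<le> ?C"
      unfolding Hinf_norm_def using g_le by (intro cSUP_least) auto
    ultimately show ?thesis by blast
  qed
  then show "\<exists>N\<ge>1. \<forall>a\<in>linf. \<exists>f\<in>Hinf. (\<forall>n\<ge>N. f (z n) = a n) \<and> Hinf_norm f \<le> (1 + \<epsilon>) * linf_tail_norm N a"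
    by (intro exI[of _ N]) (auto simp: N_def)
qed

subsection \<open>Bounded functions vanishing on finite sets\<close>

text \<open>Dividing out a zero does not raise the bound: precomposing with the disc automorphism
  that sends 0 to w reduces this to the Schwarz lemma.\<close>

lemma Schwarz_Pick_factor:
  assumes f: "f holomorphic_on ball 0 1" "\<And>z. z \<in> ball 0 1 \<Longrightarrow> cmod (f z) \<le> M"
    and w: "cmod w < 1" "f w = 0"
  obtains g where "g holomorphic_on ball 0 1" "\<And>z. z \<in> ball 0 1 \<Longrightarrow> cmod (g z) \<le> M"
    "\<And>z. z \<in> ball 0 1 \<Longrightarrow> f z = Moebius_function 0 w z * g z"
proof -
  \<comment> \<open>The quotient of f by the Moebius factor, with the removable singularity at w
    filled in by the derivative.\<close>
  define g where "g z = (1 - cnj w * z) * (if z = w then deriv f w else (f z - f w) / (z - w))" for z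
  have g: "g holomorphic_on ball 0 1"
    unfolding g_def by (intro holomorphic_intros pole_lemma_open f(1)) auto
  have fg: "f z = Moebius_function 0 w z * g z" if "z \<in> ball 0 1" for z
    using one_minus_cnj_mult_nonzero[of z w] that w by (auto simp: g_def Moebius_function_simple)
  have M0: "0 \<le> M"
    using f(2)[of 0] norm_ge_zero[of "f 0"] by (simp del: norm_ge_zero)
  have off: "cmod (g z) \<le> M" if z: "z \<in> ball 0 1" "z \<noteq> w" for z
  proof -
    let ?\<phi> = "Moebius_function 0 w" and ?\<psi> = "Moebius_function 0 (- w)"
    have \<phi>z: "cmod (?\<phi> z) < 1"
      using z w by (intro Moebius_function_norm_lt_1) auto
    have inv: "?\<psi> (?\<phi> z) = z"
      using z w by (intro Moebius_function_compose) auto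
    have \<phi>0: "?\<phi> z \<noteq> 0"
      using z w one_minus_cnj_mult_nonzero[of z w] by (simp add: Moebius_function_simple)
    \<comment> \<open>The Schwarz lemma needs a strict bound, and M may be 0, so f is scaled by an
      arbitrary M' > M; \<open>dense_ge\<close> then returns to M.\<close>
    have "cmod (f z) \<le> cmod (?\<phi> z) * M'" if M': "M' > M" for M'
    proof -
      let ?h = "\<lambda>x. (f \<circ> ?\<psi>) x / of_real M'"
      have \<psi>: "?\<psi> ` ball 0 1 \<subseteq> ball 0 1"
        using w by (auto intro!: Moebius_function_norm_lt_1)
      have "cmod (?h (?\<phi> z)) \<le> cmod (?\<phi> z)"
      proof (rule Schwarz_Lemma(1))
        show "?h holomorphic_on ball 0 1"
          using w M' M0
          by (intro holomorphic_intros holomorphic_on_compose_gen[OF _ f(1) \<psi>] Moebius_function_holomorphic) auto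
        show "?h 0 = 0"
          using w by (simp add: Moebius_function_simple)
        show "cmod (?h x) < 1" if "cmod x < 1" for x
        proof -
          have "cmod (f (?\<psi> x)) \<le> M"
            using \<psi> that by (intro f(2)) (meson image_subset_iff mem_ball_0)
          then show ?thesis
            using M' M0 by (simp add: norm_divide)
        qed
      qed (use \<phi>z in auto)
      then show ?thesis
        using M' M0 inv by (simp add: norm_divide field_simps)
    qed
    then have "cmod (g z) \<le> M'" if "M' > M" for M'
      using that fg[OF z(1)] \<phi>0 by (simp add: norm_mult)
    then show ?thesis
      by (rule dense_ge)
  qed
  \<comment> \<open>At w itself the bound follows from nearby points by continuity.\<close>
  have "cmod (g w) \<le> M"
  proof (rule tendsto_upperbound)
    show "((\<lambda>z. cmod (g z)) \<longlongrightarrow> cmod (g w)) (at w)"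
      using holomorphic_on_imp_continuous_on[OF g] w
      by (intro tendsto_norm) (simp add: continuous_on_eq_continuous_at continuous_at)
    have "\<forall>\<^sub>F z in at w. z \<in> ball 0 1 - {w}"
      using w by (intro eventually_at_in_open) auto
    then show "\<forall>\<^sub>F z in at w. cmod (g z) \<le> M"
      by eventually_elim (use off in auto)
  qed auto
  with off have "cmod (g z) \<le> M" if "z \<in> ball 0 1" for z
    using that by (cases "z = w") auto
  with g fg that show thesis by blast
qed

text \<open>Zeros are divided out one at a time. The Moebius factor for w vanishes in the disc only
  at w, so the quotient keeps the other zeros and the bound M.\<close>

lemma norm_le_prod_pseudohyp:
  assumes "finite T" "T \<subseteq> ball 0 1"
    and "f holomorphic_on ball 0 1" "\<And>z. z \<in> ball 0 1 \<Longrightarrow> cmod (f z) \<le> M"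
    and "\<And>w. w \<in> T \<Longrightarrow> f w = 0" "z \<in> ball 0 1"
  shows "cmod (f z) \<le> M * (\<Prod>w\<in>T. pseudohyp z w)"
  using assms
proof (induction T arbitrary: f rule: finite_induct)
  case empty
  then show ?case by simp
next
  case (insert w T)
  obtain g where g: "g holomorphic_on ball 0 1" "\<And>z. z \<in> ball 0 1 \<Longrightarrow> cmod (g z) \<le> M"
      "\<And>z. z \<in> ball 0 1 \<Longrightarrow> f z = Moebius_function 0 w z * g z"
    using Schwarz_Pick_factor[of f M w] insert.prems by auto
  have "g x = 0" if "x \<in> T" for x
  proof -
    have x: "x \<in> ball 0 1" "x \<noteq> w"
      using that insert by auto
    then have "Moebius_function 0 w x \<noteq> 0"
      using one_minus_cnj_mult_nonzero[of x w] insert.prems(1) by (simp add: Moebius_function_simple)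
    then show ?thesis
      using g(3)[OF x(1)] insert.prems(4)[of x] that by simp
  qed
  then have "cmod (g z) \<le> M * (\<Prod>w\<in>T. pseudohyp z w)"
    using g insert.prems by (intro insert.IH) auto
  then have "pseudohyp z w * cmod (g z) \<le> pseudohyp z w * (M * (\<Prod>w\<in>T. pseudohyp z w))"
    by (intro mult_left_mono pseudohyp_nonneg)
  then show ?case
    using insert.hyps g(3)[OF insert.prems(5)]
    by (simp add: norm_mult pseudohyp_eq_norm_Moebius mult_ac)
qed

subsection \<open>Eventual interpolating sequences are thin\<close>

lemma EIS_inf_prod_ge:
  assumes z: "\<And>n. n \<ge> 1 \<Longrightarrow> z n \<in> ball 0 1" and "EIS_inf z" and t: "0 < t" "t < 1"
  obtains N where "N \<ge> 1" "\<And>j n. j \<ge> N \<Longrightarrow> t \<le> (\<Prod>k\<in>{N..n} - {j}. pseudohyp (z j) (z k))"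
proof -
  \<comment> \<open>With \<open>\<epsilon> = 1 / t - 1\<close> the interpolation constant is exactly
    1 / t.\<close>
  have "1 / t - 1 > 0" using t by simp
  then obtain N where N: "N \<ge> 1" "\<And>a. a \<in> linf \<Longrightarrow> \<exists>f\<in>Hinf. (\<forall>n\<ge>N. f (z n) = a n) \<and>
      Hinf_norm f \<le> (1 + (1 / t - 1)) * linf_tail_norm N a"
    using \<open>EIS_inf z\<close> unfolding EIS_inf_def by meson
  have peak: "\<exists>f\<in>Hinf. f (z j) = 1 \<and> (\<forall>k\<ge>N. k \<noteq> j \<longrightarrow> f (z k) = 0) \<and> Hinf_norm f \<le> 1 / t"
    if "j \<ge> N" for j
  proof -
    let ?a = "\<lambda>n. if n = j then 1 else 0 :: complex"
    have "?a \<in> linf"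
      by (auto simp: linf_def bounded_iff intro!: exI[of _ 1])
    then obtain f where f: "f \<in> Hinf" "\<forall>n\<ge>N. f (z n) = ?a n" "Hinf_norm f \<le> 1 / t * linf_tail_norm N ?a"
      using N(2)[of ?a] by auto
    have "linf_tail_norm N ?a \<le> 1"
      unfolding linf_tail_norm_def by (intro cSUP_least) auto
    then have "1 / t * linf_tail_norm N ?a \<le> 1 / t * 1"
      using t by (intro mult_left_mono) auto
    then show ?thesis
      using f that by (intro bexI[of _ f]) auto
  qed
  \<comment> \<open>The peak function at j separates \<open>z j\<close> from the other tail points.
    Injectivity lets the product over the zero set be rewritten over indices.\<close>
  have inj: "inj_on z {N..}"
  proof (rule inj_onI)
    fix j k assume "j \<in> {N..}" "k \<in> {N..}" "z j = z k"
    then show "j = k"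
      using peak[of j] by fastforce
  qed
  have "t \<le> (\<Prod>k\<in>{N..n} - {j}. pseudohyp (z j) (z k))" if j: "j \<ge> N" for j n
  proof -
    obtain f where f: "f \<in> Hinf" "f (z j) = 1" "\<And>k. k \<ge> N \<Longrightarrow> k \<noteq> j \<Longrightarrow> f (z k) = 0" "Hinf_norm f \<le> 1 / t"
      using peak[OF j] by blast
    have "cmod (f (z j)) \<le> 1 / t * (\<Prod>w\<in>z ` ({N..n} - {j}). pseudohyp (z j) w)"
    proof (rule norm_le_prod_pseudohyp)
      show "z ` ({N..n} - {j}) \<subseteq> ball 0 1"
        using z N(1) by (meson DiffD1 atLeastAtMost_iff image_subsetI order_trans)
      show "f w = 0" if "w \<in> z ` ({N..n} - {j})" for w
        using that f(3) by fastforce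
      show "f holomorphic_on ball 0 1"
        using f(1) by (simp add: Hinf_def)
      show "cmod (f w) \<le> 1 / t" if "w \<in> ball 0 1" for w
        using norm_le_Hinf_norm[OF f(1) that] f(4) by linarith
    qed (use z N(1) j in simp_all)
    also have "(\<Prod>w\<in>z ` ({N..n} - {j}). pseudohyp (z j) w) = (\<Prod>k\<in>{N..n} - {j}. pseudohyp (z j) (z k))"
      using inj by (subst prod.reindex) (auto intro: inj_on_subset)
    finally show ?thesis
      using f(2) t by (simp add: field_simps)
  qed
  with N(1) that show thesis by blast
qed

text \<open>The partial products decrease to a positive limit, and x n is the ratio of two
  consecutive ones.\<close>

lemma tendsto_1_of_prod_ge:
  fixes x :: "nat \<Rightarrow> real"
  assumes x: "\<And>n. 0 \<le> x n" "\<And>n. x n \<le> 1" and t: "0 < t" "\<And>n. t \<le> (\<Prod>k<n. x k)"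
  shows "x \<longlonglongrightarrow> 1"
proof -
  let ?P = "\<lambda>n. \<Prod>k<n. x k"
  have "decseq ?P"
  proof (rule decseq_SucI)
    show "?P (Suc n) \<le> ?P n" for n
      unfolding prod.lessThan_Suc using x by (intro mult_left_le prod_nonneg) auto
  qed
  then obtain l where l: "?P \<longlonglongrightarrow> l"
    using decseq_convergent[of ?P t] t by blast
  then have "t \<le> l"
    using t by (intro LIMSEQ_le_const) auto
  then have "(\<lambda>n. ?P (Suc n) / ?P n) \<longlonglongrightarrow> l / l"
    using l t by (intro tendsto_divide LIMSEQ_Suc) auto
  moreover have "?P (Suc n) / ?P n = x n" for n
  proof -
    have "?P n \<noteq> 0"
      using t(1) t(2)[of n] by linarith
    then show ?thesis
      by (simp del: prod_zero_iff)
  qed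
  ultimately show ?thesis
    using \<open>t \<le> l\<close> t by simp
qed

text \<open>The hypothesis forces |z n| -> 1, which in turn gives the limit for every w. Both halves
  use \<open>one_minus_pseudohyp_sq\<close>, with |1 - cnj v u| bounded above by 2 for the first and
  below by 1 - |w| for the second.\<close>

lemma pseudohyp_tendsto_1_transfer:
  assumes z: "\<And>n. n \<ge> 1 \<Longrightarrow> z n \<in> ball 0 1" and c: "cmod c < 1" and w: "cmod w < 1"
    and lim: "(\<lambda>n. pseudohyp c (z n)) \<longlonglongrightarrow> 1"
  shows "(\<lambda>n. pseudohyp (z n) w) \<longlonglongrightarrow> 1"
proof -
  have le2: "cmod (1 - cnj v * u) \<le> 2" if "cmod u < 1" "cmod v < 1" for u v
    using norm_triangle_ineq4[of 1 "cnj v * u"] norm_mult_less[of "cnj v" 1 u 1] that by simp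
  have c': "0 < 1 - (cmod c)\<^sup>2"
    using c by (simp add: abs_square_less_1)
  have "(\<lambda>n. 4 / (1 - (cmod c)\<^sup>2) * (1 - (pseudohyp c (z n))\<^sup>2)) \<longlonglongrightarrow> 4 / (1 - (cmod c)\<^sup>2) * (1 - 1\<^sup>2)"
    by (intro tendsto_intros lim)
  then have up: "(\<lambda>n. 4 / (1 - (cmod c)\<^sup>2) * (1 - (pseudohyp c (z n))\<^sup>2)) \<longlonglongrightarrow> 0"
    by simp
  have z_le: "1 - (cmod (z n))\<^sup>2 \<le> 4 / (1 - (cmod c)\<^sup>2) * (1 - (pseudohyp c (z n))\<^sup>2)" if "n \<ge> 1" for n
  proof -
    have zn: "cmod (z n) < 1" using z[OF that] by simp
    then have "0 \<le> 1 - (cmod (z n))\<^sup>2" by (simp add: power_le_one)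
    moreover have "(cmod (1 - cnj (z n) * c))\<^sup>2 \<le> 2\<^sup>2"
      using le2 c zn by (intro power_mono) auto
    moreover have "0 < (cmod (1 - cnj (z n) * c))\<^sup>2"
      using one_minus_cnj_mult_nonzero[OF c zn] by simp
    ultimately have "(1 - (cmod c)\<^sup>2) * (1 - (cmod (z n))\<^sup>2) / 4 \<le> 1 - (pseudohyp c (z n))\<^sup>2"
      unfolding one_minus_pseudohyp_sq[OF c zn] using c' by (intro frac_le) auto
    then show ?thesis
      using c' by (simp add: field_simps)
  qed
  have z_ge: "0 \<le> 1 - (cmod (z n))\<^sup>2" if "n \<ge> 1" for n
    using z[OF that] by (simp add: power_le_one)
  have zlim: "(\<lambda>n. 1 - (cmod (z n))\<^sup>2) \<longlonglongrightarrow> 0"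
    by (rule real_tendsto_sandwich[OF eventually_sequentiallyI[of 1, OF z_ge]
          eventually_sequentiallyI[of 1, OF z_le] tendsto_const up])
  have "(\<lambda>n. 1 - (1 - (cmod (z n))\<^sup>2) / (1 - cmod w)\<^sup>2) \<longlonglongrightarrow> 1 - 0 / (1 - cmod w)\<^sup>2"
    using w by (intro tendsto_intros zlim) auto
  then have low: "(\<lambda>n. 1 - (1 - (cmod (z n))\<^sup>2) / (1 - cmod w)\<^sup>2) \<longlonglongrightarrow> 1"
    by simp
  have bounds: "1 - (1 - (cmod (z n))\<^sup>2) / (1 - cmod w)\<^sup>2 \<le> (pseudohyp (z n) w)\<^sup>2 \<and> (pseudohyp (z n) w)\<^sup>2 \<le> 1"
    if "n \<ge> 1" for n
  proof
    have zn: "cmod (z n) < 1" using z[OF that] by simp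
    have "cmod (cnj w * z n) \<le> cmod w"
      using zn by (simp add: norm_mult mult_left_le)
    then have "1 - cmod w \<le> cmod (1 - cnj w * z n)"
      using norm_triangle_ineq2[of 1 "cnj w * z n"] by simp
    then have "(1 - cmod w)\<^sup>2 \<le> (cmod (1 - cnj w * z n))\<^sup>2"
      using w by (intro power_mono) auto
    moreover have "(1 - (cmod (z n))\<^sup>2) * (1 - (cmod w)\<^sup>2) \<le> 1 - (cmod (z n))\<^sup>2"
      using zn w by (intro mult_left_le) (auto simp: power_le_one)
    moreover have "0 \<le> 1 - (cmod (z n))\<^sup>2" "0 \<le> 1 - (cmod w)\<^sup>2"
      using zn w by (auto simp: power_le_one)
    ultimately have "1 - (pseudohyp (z n) w)\<^sup>2 \<le> (1 - (cmod (z n))\<^sup>2) / (1 - cmod w)\<^sup>2"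
      unfolding one_minus_pseudohyp_sq[OF zn w] using w by (intro frac_le) auto
    then show "1 - (1 - (cmod (z n))\<^sup>2) / (1 - cmod w)\<^sup>2 \<le> (pseudohyp (z n) w)\<^sup>2"
      by simp
    show "(pseudohyp (z n) w)\<^sup>2 \<le> 1"
      using z[OF that] w by (intro power_le_one pseudohyp_nonneg pseudohyp_le_1) auto
  qed
  have "(\<lambda>n. (pseudohyp (z n) w)\<^sup>2) \<longlonglongrightarrow> 1"
    by (rule real_tendsto_sandwich[OF eventually_sequentiallyI[of 1] eventually_sequentiallyI[of 1] low tendsto_const])
      (use bounds in auto)
  then have "(\<lambda>n. sqrt ((pseudohyp (z n) w)\<^sup>2)) \<longlonglongrightarrow> sqrt 1"
    by (rule tendsto_real_sqrt)
  then show ?thesis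
    by (simp add: pseudohyp_nonneg)
qed

lemma EIS_inf_imp_thin:
  assumes z: "\<And>n. n \<ge> 1 \<Longrightarrow> z n \<in> ball 0 1" and "EIS_inf z"
  shows "thin z"
proof -
  have rho_lim: "(\<lambda>n. pseudohyp (z n) (z k)) \<longlonglongrightarrow> 1" if "k \<ge> 1" for k
  proof -
    \<comment> \<open>Any constant in (0, 1) would do: a positive lower bound on the tail product at
      the single point \<open>z N\<close> suffices.\<close>
    obtain N where N: "N \<ge> 1" "\<And>j n. j \<ge> N \<Longrightarrow> 1 / 2 \<le> (\<Prod>k\<in>{N..n} - {j}. pseudohyp (z j) (z k))"
      using EIS_inf_prod_ge[of z "1 / 2"] assms by auto
    have "(\<lambda>n. pseudohyp (z N) (z (n + Suc N))) \<longlonglongrightarrow> 1"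
    proof (rule tendsto_1_of_prod_ge)
      show "1 / 2 \<le> (\<Prod>k<n. pseudohyp (z N) (z (k + Suc N)))" for n
      proof -
        have "{N..N + n} - {N} = (\<lambda>k. k + Suc N) ` {..<n}"
          unfolding lessThan_atLeast0 image_add_atLeastLessThan' by auto
        then have "(\<Prod>k\<in>{N..N + n} - {N}. pseudohyp (z N) (z k)) = (\<Prod>k<n. pseudohyp (z N) (z (k + Suc N)))"
          by (simp add: prod.reindex inj_on_def)
        with N(2)[of N "N + n"] show ?thesis by simp
      qed
    qed (use z N(1) in \<open>auto intro!: pseudohyp_nonneg pseudohyp_le_1\<close>)
    then have "(\<lambda>n. pseudohyp (z N) (z n)) \<longlonglongrightarrow> 1"
      by (rule LIMSEQ_offset)
    then show ?thesis
      using z[of N] z[of k] N(1) that z by (intro pseudohyp_tendsto_1_transfer[of z "z N"]) auto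
  qed
  show ?thesis
    unfolding thin_def
  proof (rule order_tendstoI)
    fix y :: real
    assume "1 < y"
    moreover have "thin_product z j \<le> 1" if "j \<ge> 1" for j
      using thin_product_le_prod[where z = z and j = j and S = "{}"] z that by simp
    ultimately show "\<forall>\<^sub>F j in sequentially. thin_product z j < y"
      by (intro eventually_sequentiallyI[of 1]) (meson order_le_less_trans)
  next
    fix y :: real
    assume "y < 1"
    \<comment> \<open>A point strictly between max(y, 0) and 1; \<open>EIS_inf_prod_ge\<close> needs
      t > 0, while y may be negative.\<close>
    define t where "t = (max y 0 + 1) / 2"
    have t: "0 < t" "t < 1" "y < t"
      using \<open>y < 1\<close> by (auto simp: t_def max_def)
    obtain N where N: "N \<ge> 1" "\<And>j n. j \<ge> N \<Longrightarrow> t \<le> (\<Prod>k\<in>{N..n} - {j}. pseudohyp (z j) (z k))"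
      using EIS_inf_prod_ge[of z t] assms t by auto
    \<comment> \<open>The head has a fixed finite number of factors, each tending to 1, so it costs
      nothing in the limit.\<close>
    let ?Q = "\<lambda>j. \<Prod>k\<in>{1..<N}. pseudohyp (z j) (z k)"
    have "(\<lambda>j. ?Q j * t) \<longlonglongrightarrow> (\<Prod>k\<in>{1..<N}. 1) * t"
      using rho_lim by (intro tendsto_intros) auto
    then have y_less: "\<forall>\<^sub>F j in sequentially. y < ?Q j * t"
      using t by (intro order_tendstoD(1)) auto
    have Q_le: "?Q j * t \<le> thin_product z j" if "j \<ge> N" for j
    proof (rule LIMSEQ_le_const[OF thin_product_LIMSEQ[OF z]])
      have "?Q j * t \<le> (\<Prod>k\<in>{1..n} - {j}. pseudohyp (z j) (z k))" if "n \<ge> N" for n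
      proof -
        have split: "{1..n} - {j} = {1..<N} \<union> ({N..n} - {j})"
          using that \<open>j \<ge> N\<close> N(1) by auto
        have "(\<Prod>k\<in>{1..n} - {j}. pseudohyp (z j) (z k)) = ?Q j * (\<Prod>k\<in>{N..n} - {j}. pseudohyp (z j) (z k))"
          unfolding split by (rule prod.union_disjoint) auto
        then show ?thesis
          using N(2)[OF \<open>j \<ge> N\<close>, of n]
          by (simp add: mult_left_mono prod_nonneg pseudohyp_nonneg)
      qed
      then show "\<exists>M. \<forall>n\<ge>M. ?Q j * t \<le> (\<Prod>k\<in>{1..n} - {j}. pseudohyp (z j) (z k))"
        by blast
    qed (use that N in auto)
    show "\<forall>\<^sub>F j in sequentially. y < thin_product z j"
      using y_less eventually_ge_at_top[of N]
      by eventually_elim (rule order_less_le_trans[OF _ Q_le])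
  qed
qed

theorem corollary2p7:
  fixes z :: "nat \<Rightarrow> complex"
  assumes "\<forall>n\<ge>1. z n \<in> ball 0 1"
  shows "thin z \<longleftrightarrow> EIS_inf z"
  using thin_imp_EIS_inf[of z] EIS_inf_imp_thin[of z] assms by blast

end
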